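(* Let $(S,\ast)$ be a commutative adequate partial semigroup, let $\mathcal{T}$ be the set of all adequate sequences in $S$, and let $C$ be a central subset of $S$. Then there exist functions $\alpha:\mathcal{P}_{f}(\mathcal{T})\rightarrow S$ and $H:\mathcal{P}_{f}(\mathcal{T})\rightarrow\mathcal{P}_{f}(\mathbb{N})$ such that (1) if $F,G\in\mathcal{P}_{f}(\mathcal{T})$ and $F\subsetneq G$, then $\max H(F) < \min H(G)$; and (2) whenever $m\in\mathbb{N}$, $G_{1},G_{2},\ldots,G_{m}\in\mathcal{P}_{f}(\mathcal{T})$ with $G_{1}\subsetneq G_{2}\subsetneq\cdots\subsetneq G_{m}$, and $f_i \in G_{i}$ for each $i\in\{1,2,\ldots,m\}$, the product $\prod_{i=1}^{m}\big(\alpha(G_{i})\ast\prod_{t\in H(G_{i})}f_i(t)\big)$ is defined and belongs to $C$.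
   Context: A partial semigroup is a pair $(S,\ast)$ where $\ast$ is an operation defined on a subset $X\subseteq S\times S$ such that for all $x,y,z\in S$, $(x\ast y)\ast z=x\ast(y\ast z)$ in the sense that if either side is defined then so is the other and they are equal; it is commutative if $x\ast y=y\ast x$ whenever defined. For $s\in S$, $\phi(s)=\{t\in S: s\ast t \text{ is defined}\}$; for finite nonempty $K\subseteq S$, $\sigma(K)=\bigcap_{s\in K}\phi(s)$. $(S,\ast)$ is adequate if $\sigma(K)\neq\emptyset$ for every finite nonempty $K\subseteq S$. $\mathcal{P}_f(X)$ denotes the set of finite nonempty subsets of $X$. A sequence $\langle y_n\rangle_{n=1}^\infty$ in $S$ is adequate if $\prod_{n\in F}y_n$ is defined for every $F\in\mathcal{P}_f(\mathbb{N})$ and for every $K\in\mathcal{P}_f(S)$ there is $m\in\mathbb{N}$ with $\{\prod_{n\in F}y_n: F\in\mathcal{P}_f(\mathbb{N}), \min F\ge m\}\subseteq\sigma(K)$. Identify $\beta S$ with the set of ultrafilters on $S$ (principal ultrafilters identified with points of $S$), with topology generated by the sets $\overline{A}=\{p\in\beta S: A\in p\}$. Let $\delta S=\bigcap_{x\in S}\overline{\phi(x)}$. For $a\in S$ and $A\subseteq S$ let $a^{-1}A=\{t\in\phi(a): a\ast t\in A\}$; for $p\in\beta S$, $q\in\delta S$ define $p\ast q=\{A\subseteq S: \{a\in S: a^{-1}A\in q\}\in p\}$. With this operation $\delta S$ is a compact right topological semigroup; $K(\delta S)$ denotes its smallest two-sided ideal. A set $C\subseteq S$ is central if there is an idempotent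 $p\in\overline{C}\cap K(\delta S)$. *)

theory Defs
  imports Main "HOL-Library.FuncSet"
begin

(* A partial semigroup on the set S is an operation f :: 'a => 'a => 'a option, where the
   type 'a is S and f x y = None means that x * y is undefined. *)

definition finite_subsets :: "'b set \<Rightarrow> 'b set set" where
  "finite_subsets X = {F. finite F \<and> F \<noteq> {} \<and> F \<subseteq> X}"

(* The operation on possibly undefined values: undefined as soon as an argument is. *)
definition pmult :: "('a \<Rightarrow> 'a \<Rightarrow> 'a option) \<Rightarrow> 'a option \<Rightarrow> 'a option \<Rightarrow> 'a option" where
  "pmult f u v = Option.bind u (\<lambda>x. Option.bind v (f x))"

(* The equalities in the next two definitions are between options, so they say that if
   either side is defined then so is the other and they are equal. *)
definition partial_semigroup :: "('a \<Rightarrow> 'a \<Rightarrow> 'a option) \<Rightarrow> bool" where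
  "partial_semigroup f \<longleftrightarrow>
     (\<forall>x y z. pmult f (f x y) (Some z) = pmult f (Some x) (f y z))"

definition partial_commutative :: "('a \<Rightarrow> 'a \<Rightarrow> 'a option) \<Rightarrow> bool" where
  "partial_commutative f \<longleftrightarrow> (\<forall>x y. f x y = f y x)"

definition phi :: "('a \<Rightarrow> 'a \<Rightarrow> 'a option) \<Rightarrow> 'a \<Rightarrow> 'a set" where
  "phi f s = {t. f s t \<noteq> None}"

definition sigma :: "('a \<Rightarrow> 'a \<Rightarrow> 'a option) \<Rightarrow> 'a set \<Rightarrow> 'a set" where
  "sigma f K = (\<Inter>s\<in>K. phi f s)"

definition adequate :: "('a \<Rightarrow> 'a \<Rightarrow> 'a option) \<Rightarrow> bool" where
  "adequate f \<longleftrightarrow> (\<forall>K\<in>finite_subsets UNIV. sigma f K \<noteq> {})"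

(* By associativity the bracketing is immaterial; the value at [] is never used. *)
fun plist :: "('a \<Rightarrow> 'a \<Rightarrow> 'a option) \<Rightarrow> 'a option list \<Rightarrow> 'a option" where
  "plist f [] = None"
| "plist f [u] = u"
| "plist f (u # v # us) = pmult f u (plist f (v # us))"

(* Product of possibly undefined terms over a finite nonempty set of indices,
   taken in increasing order of the indices. *)
definition pprod :: "('a \<Rightarrow> 'a \<Rightarrow> 'a option) \<Rightarrow> (nat \<Rightarrow> 'a option) \<Rightarrow> nat set \<Rightarrow> 'a option" where
  "pprod f u F = plist f (map u (sorted_list_of_set F))"

abbreviation seq_prod :: "('a \<Rightarrow> 'a \<Rightarrow> 'a option) \<Rightarrow> (nat \<Rightarrow> 'a) \<Rightarrow> nat set \<Rightarrow> 'a option" where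
  "seq_prod f y F \<equiv> pprod f (\<lambda>n. Some (y n)) F"

(* Sequences are indexed by nat, i.e. starting from 0 instead of 1. *)
definition adequate_seq :: "('a \<Rightarrow> 'a \<Rightarrow> 'a option) \<Rightarrow> (nat \<Rightarrow> 'a) \<Rightarrow> bool" where
  "adequate_seq f y \<longleftrightarrow>
     (\<forall>F\<in>finite_subsets UNIV. seq_prod f y F \<noteq> None) \<and>
     (\<forall>K\<in>finite_subsets UNIV. \<exists>m.
        {the (seq_prod f y F) | F. F \<in> finite_subsets UNIV \<and> m \<le> Min F} \<subseteq> sigma f K)"

definition is_ultrafilter :: "'a set set \<Rightarrow> bool" where
  "is_ultrafilter p \<longleftrightarrow>
     UNIV \<in> p \<and> {} \<notin> p \<and>
     (\<forall>A B. A \<in> p \<longrightarrow> B \<in> p \<longrightarrow> A \<inter> B \<in> p) \<and>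
     (\<forall>A B. A \<in> p \<longrightarrow> A \<subseteq> B \<longrightarrow> B \<in> p) \<and>
     (\<forall>A. A \<in> p \<or> - A \<in> p)"

definition beta :: "'a set set set" where
  "beta = {p. is_ultrafilter p}"

definition beta_closure :: "'a set \<Rightarrow> 'a set set set" where
  "beta_closure A = {p \<in> beta. A \<in> p}"

definition delta :: "('a \<Rightarrow> 'a \<Rightarrow> 'a option) \<Rightarrow> 'a set set set" where
  "delta f = (\<Inter>x. beta_closure (phi f x))"

definition left_quotient :: "('a \<Rightarrow> 'a \<Rightarrow> 'a option) \<Rightarrow> 'a \<Rightarrow> 'a set \<Rightarrow> 'a set" where
  "left_quotient f a A = {t \<in> phi f a. the (f a t) \<in> A}"

definition ultra_mult ::
  "('a \<Rightarrow> 'a \<Rightarrow> 'a option) \<Rightarrow> 'a set set \<Rightarrow> 'a set set \<Rightarrow> 'a set set" where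
  "ultra_mult f p q = {A. {a. left_quotient f a A \<in> q} \<in> p}"

definition two_sided_ideal :: "('b \<Rightarrow> 'b \<Rightarrow> 'b) \<Rightarrow> 'b set \<Rightarrow> 'b set \<Rightarrow> bool" where
  "two_sided_ideal g T I \<longleftrightarrow>
     I \<noteq> {} \<and> I \<subseteq> T \<and> (\<forall>p\<in>I. \<forall>q\<in>T. g p q \<in> I \<and> g q p \<in> I)"

(* Equal to the smallest two-sided ideal of T whenever there is one, see smallest_ideal_eq;
   a compact right topological semigroup has one. *)
definition smallest_ideal :: "('b \<Rightarrow> 'b \<Rightarrow> 'b) \<Rightarrow> 'b set \<Rightarrow> 'b set" where
  "smallest_ideal g T = \<Inter>{I. two_sided_ideal g T I}"

lemma smallest_ideal_eq:
  assumes "two_sided_ideal g T K" and "\<And>I. two_sided_ideal g T I \<Longrightarrow> K \<subseteq> I"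
  shows "smallest_ideal g T = K"
  using assms unfolding smallest_ideal_def by blast

definition central :: "('a \<Rightarrow> 'a \<Rightarrow> 'a option) \<Rightarrow> 'a set \<Rightarrow> bool" where
  "central f C \<longleftrightarrow>
     (\<exists>p \<in> beta_closure C \<inter> smallest_ideal (ultra_mult f) (delta f). ultra_mult f p p = p)"

lemma left_quotient_left_quotient:
  assumes "partial_semigroup f" "f a b = Some c"
  shows "left_quotient f b (left_quotient f a A) = left_quotient f c A"
proof -
  have *: "f c t = Option.bind (f b t) (f a)" for t
    using assms unfolding partial_semigroup_def pmult_def by (metis Option.bind.bind_lunit)
  show ?thesis
    by (auto simp: left_quotient_def phi_def * bind_eq_Some_conv)
qed

lemma ultra_mult_in_delta:
  assumes "partial_semigroup f" "p \<in> delta f" "q \<in> delta f"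
  shows "ultra_mult f p q \<in> delta f"
proof -
  have p: "is_ultrafilter p" and pd: "\<And>x. phi f x \<in> p"
    using assms(2) by (auto simp: delta_def beta_closure_def beta_def)
  have q: "is_ultrafilter q" and qd: "\<And>x. phi f x \<in> q"
    using assms(3) by (auto simp: delta_def beta_closure_def beta_def)
  have qup: "A \<in> q \<Longrightarrow> A \<subseteq> B \<Longrightarrow> B \<in> q" for A B
    using q unfolding is_ultrafilter_def by blast
  have pup: "A \<in> p \<Longrightarrow> A \<subseteq> B \<Longrightarrow> B \<in> p" for A B
    using p unfolding is_ultrafilter_def by blast
  have qi: "A \<inter> B \<in> q \<longleftrightarrow> A \<in> q \<and> B \<in> q" for A B
    using q qup unfolding is_ultrafilter_def by (meson inf.cobounded1 inf.cobounded2)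
  have pi: "A \<inter> B \<in> p \<longleftrightarrow> A \<in> p \<and> B \<in> p" for A B
    using p pup unfolding is_ultrafilter_def by (meson inf.cobounded1 inf.cobounded2)
  have qc: "- A \<in> q \<longleftrightarrow> A \<notin> q" for A
    using q unfolding is_ultrafilter_def by (metis Compl_disjoint)
  have pc: "- A \<in> p \<longleftrightarrow> A \<notin> p" for A
    using p unfolding is_ultrafilter_def by (metis Compl_disjoint)
  have U: "left_quotient f a UNIV = phi f a" "left_quotient f a {} = {}"
    "left_quotient f a (A \<inter> B) = left_quotient f a A \<inter> left_quotient f a B"
    "left_quotient f a (- A) = phi f a \<inter> - left_quotient f a A" for a A B
    by (auto simp: left_quotient_def)
  have [simp]: "UNIV \<in> p" "UNIV \<in> q" "{} \<notin> p" "{} \<notin> q"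
    using p q unfolding is_ultrafilter_def by auto
  have int: "A \<inter> B \<in> ultra_mult f p q \<longleftrightarrow> A \<in> ultra_mult f p q \<and> B \<in> ultra_mult f p q" for A B
    by (simp add: ultra_mult_def U qi Collect_conj_eq pi)
  have "is_ultrafilter (ultra_mult f p q)"
    unfolding is_ultrafilter_def
  proof (intro conjI allI impI)
    show "UNIV \<in> ultra_mult f p q" "{} \<notin> ultra_mult f p q"
      by (simp_all add: ultra_mult_def U qd)
    show "A \<inter> B \<in> ultra_mult f p q" if "A \<in> ultra_mult f p q" "B \<in> ultra_mult f p q" for A B
      using that int by blast
    show "B \<in> ultra_mult f p q" if "A \<in> ultra_mult f p q" "A \<subseteq> B" for A B
      using that int[of A B] by (simp add: Int_absorb2)
    show "A \<in> ultra_mult f p q \<or> - A \<in> ultra_mult f p q" for A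
      by (simp add: ultra_mult_def U qi qc qd Collect_neg_eq pc)
  qed
  moreover have "phi f x \<in> ultra_mult f p q" for x
  proof -
    have "phi f x \<subseteq> {a. left_quotient f a (phi f x) \<in> q}"
    proof
      fix a assume "a \<in> phi f x"
      then obtain c where c: "f x a = Some c" by (auto simp: phi_def)
      have "left_quotient f a (phi f x) = phi f c"
        using left_quotient_left_quotient[OF assms(1) c, of UNIV] by (simp add: U)
      then show "a \<in> {a. left_quotient f a (phi f x) \<in> q}" by (simp add: qd)
    qed
    then show ?thesis
      unfolding ultra_mult_def using pup pd by blast
  qed
  ultimately show ?thesis
    by (auto simp: delta_def beta_closure_def beta_def)
qed

end

theory Submission
  imports Defs
begin

text \<open>
  Call \<open>A\<close> a J-set if for all finite sets \<open>F\<close> of adequate sequences there are \<open>a\<close> and an arbitrarily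
  late \<open>H\<close> with \<open>a * (\<Prod>t\<in>H. y t) \<in> A\<close> for all \<open>y \<in> F\<close>. By the Hales-Jewett theorem, applied to
  the products \<open>a * y\<^sub>1 t\<^sub>1 * \<dots> * y\<^sub>n t\<^sub>n\<close> with letters \<open>y\<^sub>i \<in> F\<close>, no \<open>\<sigma>(L)\<close> is covered by
  finitely many sets that are not J-sets. Hence some ultrafilter in \<open>\<delta>S\<close> consists of J-sets. The
  ultrafilters of this kind form a two-sided ideal, which therefore contains \<open>K(\<delta>S)\<close>: no minimal
  left ideals are needed. So for an idempotent \<open>p \<in> K(\<delta>S)\<close> containing \<open>C\<close>, all members of \<open>p\<close>
  are J-sets, and \<open>\<alpha> G\<close> and \<open>H G\<close> are chosen by recursion on \<open>G\<close>, keeping all products in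
  \<open>{x \<in> C. x\<^sup>-\<^sup>1C \<in> p}\<close>.
\<close>

subsection \<open>The Hales-Jewett theorem\<close>

definition words :: "'b set \<Rightarrow> nat \<Rightarrow> 'b list set" where
  "words F n = {w. set w \<subseteq> F \<and> length w = n}"

text \<open>In a variable word, \<^term>\<open>None\<close> marks the positions of the variable.\<close>

definition variable_words :: "'b set \<Rightarrow> nat \<Rightarrow> 'b option list set" where
  "variable_words F n = {w. set w \<subseteq> insert None (Some ` F) \<and> length w = n \<and> None \<in> set w}"

definition subst_word :: "'b \<Rightarrow> 'b option list \<Rightarrow> 'b list" where
  "subst_word x w = map (case_option x id) w"

lemma subst_word_append [simp]: "subst_word x (v @ w) = subst_word x v @ subst_word x w"
  by (simp add: subst_word_def)

lemma subst_word_map_Some [simp]: "subst_word x (map Some v) = v"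
  by (induction v) (simp_all add: subst_word_def)

lemma finite_words: "finite F \<Longrightarrow> finite (words F n)"
  unfolding words_def by (rule finite_lists_length_eq)

lemma words_append: "u \<in> words F m \<Longrightarrow> v \<in> words F n \<Longrightarrow> u @ v \<in> words F (m + n)"
  by (auto simp: words_def)

lemma words_mono: "F \<subseteq> G \<Longrightarrow> words F n \<subseteq> words G n"
  by (auto simp: words_def)

lemma subst_word_in_words: "w \<in> variable_words F n \<Longrightarrow> x \<in> F \<Longrightarrow> subst_word x w \<in> words F n"
  by (fastforce simp: variable_words_def words_def subst_word_def split: option.split)

lemma variable_words_mono: "F \<subseteq> G \<Longrightarrow> variable_words F n \<subseteq> variable_words G n"
  by (auto simp: variable_words_def)

lemma variable_words_append:
  "v \<in> variable_words F m \<Longrightarrow> w \<in> variable_words F n \<Longrightarrow> v @ w \<in> variable_words F (m + n)"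
  by (auto simp: variable_words_def)

lemma variable_words_append_word:
  "v \<in> variable_words F m \<Longrightarrow> w \<in> words F n \<Longrightarrow> v @ map Some w \<in> variable_words F (m + n)"
  by (auto simp: variable_words_def words_def)

lemma word_append_variable_words:
  "v \<in> words F m \<Longrightarrow> w \<in> variable_words F n \<Longrightarrow> map Some v @ w \<in> variable_words F (m + n)"
  by (auto simp: variable_words_def words_def)

text \<open>Comparing letters pairwise, instead of naming the common colour, lets the empty alphabet
  be covered vacuously.\<close>

definition monochromatic :: "('b list \<Rightarrow> nat) \<Rightarrow> 'b set \<Rightarrow> 'b option list \<Rightarrow> bool" where
  "monochromatic \<chi> F w \<longleftrightarrow> (\<forall>x\<in>F. \<forall>y\<in>F. \<chi> (subst_word x w) = \<chi> (subst_word y w))"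

lemma monochromaticI:
  "(\<And>x. x \<in> F \<Longrightarrow> \<chi> (subst_word x w) = c) \<Longrightarrow> monochromatic \<chi> F w"
  by (simp add: monochromatic_def)

text \<open>Induction on the alphabet. The number of colours \<open>r\<close> stays arbitrary
  because the step applies the hypothesis for \<open>F\<close> with far more colours, one for each
  \<open>r\<close>-colouring of the words of a fixed length. Once \<open>focus\<close> has collected
  lines of all \<open>r\<close> colours, the common end point must share a colour with one of them,
  and that line is monochromatic on \<open>insert z F\<close>.\<close>

lemma hales_jewett:
  fixes F :: "'b set"
  assumes "finite F"
  shows "\<exists>n. \<forall>\<chi>. \<chi> ` words F n \<subseteq> {..<r} \<longrightarrow> (\<exists>w\<in>variable_words F n. monochromatic \<chi> F w)"
  using assms
proof (induction F arbitrary: r rule: finite_induct)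
  case empty
  have "[None] \<in> variable_words {} 1" by (simp add: variable_words_def)
  then show ?case by (meson monochromatic_def empty_iff)
next
  case (insert z F)
  let ?F = "insert z F"
  show ?case
  proof (cases "F = {}")
    \<comment> \<open>With a single letter there is nothing to compare. The case is separate because
      focusing needs a letter \<open>x0\<close> of \<open>F\<close>.\<close>
    case True
    have "[None] \<in> variable_words ?F 1" by (simp add: variable_words_def)
    moreover have "monochromatic \<chi> ?F [None]" for \<chi>
      using True by (simp add: monochromatic_def)
    ultimately show ?thesis by blast
  next
    case False
    then obtain x0 where x0: "x0 \<in> F" by blast
    \<comment> \<open>Colour focusing: the lines with colours in \<open>K\<close> share the end point \<open>e\<close>.\<close>
    have focus: "\<exists>n. \<forall>\<chi>. \<chi> ` words ?F n \<subseteq> {..<r} \<longrightarrow>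
        (\<exists>w\<in>variable_words ?F n. monochromatic \<chi> ?F w) \<or>
        (\<exists>e\<in>words ?F n. \<exists>K\<subseteq>{..<r}. card K = s \<and>
          (\<forall>c\<in>K. \<exists>w\<in>variable_words ?F n. subst_word z w = e \<and> (\<forall>x\<in>F. \<chi> (subst_word x w) = c)))" for s
    proof (induction s)
      case 0
      have "[] \<in> words ?F 0" by (simp add: words_def)
      then show ?case by (intro exI[of _ 0] allI impI disjI2 bexI[of _ "[]"] exI[of _ "{}"]) auto
    next
      case (Suc s)
      then obtain n where n: "\<And>\<chi>. \<chi> ` words ?F n \<subseteq> {..<r} \<Longrightarrow>
        (\<exists>w\<in>variable_words ?F n. monochromatic \<chi> ?F w) \<or>
        (\<exists>e\<in>words ?F n. \<exists>K\<subseteq>{..<r}. card K = s \<and>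
          (\<forall>c\<in>K. \<exists>w\<in>variable_words ?F n. subst_word z w = e \<and> (\<forall>x\<in>F. \<chi> (subst_word x w) = c)))"
        by blast
      \<comment> \<open>A prefix \<open>u\<close> of length \<open>N\<close> will be coloured by the
        whole function \<open>v \<mapsto> \<chi> (u @ v)\<close> on suffixes of length
        \<open>n\<close>. Taking these functions extensional leaves finitely many of them, and
        \<open>enc\<close> numbers them.\<close>
      let ?col = "words ?F n \<rightarrow>\<^sub>E {..<r}"
      have fin: "finite ?col"
        using insert.hyps by (intro finite_PiE finite_words) auto
      obtain R and enc :: "('b list \<Rightarrow> nat) \<Rightarrow> nat"
        where enc: "enc ` ?col = {i. i < R}" "inj_on enc ?col"
        using finite_imp_inj_to_nat_seg[OF fin] by blast
      have encR: "enc g < R" if "g \<in> ?col" for g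
        using enc(1) that by blast
      obtain N where N: "\<And>\<chi>. \<chi> ` words F N \<subseteq> {..<R} \<Longrightarrow>
          \<exists>w\<in>variable_words F N. monochromatic \<chi> F w"
        using insert.IH by blast
      show ?case
      proof (intro exI[of _ "N + n"] allI impI)
        fix \<chi> assume \<chi>: "\<chi> ` words ?F (N + n) \<subseteq> {..<r}"
        define row where "row u = (\<lambda>v\<in>words ?F n. \<chi> (u @ v))" for u
        have row: "row u \<in> ?col" if "u \<in> words ?F N" for u
          using that \<chi> by (auto simp: row_def intro!: words_append)
        have FF: "words F N \<subseteq> words ?F N" by (intro words_mono) auto
        have "(enc \<circ> row) ` words F N \<subseteq> {..<R}"
          using encR[OF row] FF by auto
        then obtain u where u: "u \<in> variable_words F N" "monochromatic (enc \<circ> row) F u"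
          using N by blast
        have u': "u \<in> variable_words ?F N"
          using u(1) variable_words_mono[of F ?F N] by auto
        define b where "b = subst_word x0 u"
        have b: "b \<in> words ?F N"
          unfolding b_def using subst_word_in_words[OF u'] x0 by simp
        \<comment> \<open>Along the line \<open>u\<close>, all letters of \<open>F\<close> induce
          the same colouring of suffixes, so \<open>\<chi>'\<close> can be computed from any of
          them. The letter \<open>z\<close> is exempt.\<close>
        have same: "\<chi> (subst_word x u @ v) = \<chi> (b @ v)" if "x \<in> F" "v \<in> words ?F n" for x v
        proof -
          have "enc (row (subst_word x u)) = enc (row b)"
            using u(2) that(1) x0 unfolding monochromatic_def b_def comp_def by blast
          then have "row (subst_word x u) = row b"
            by (rule inj_onD[OF enc(2)]) (use row b subst_word_in_words[OF u'] that(1) in auto)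
          then have "row (subst_word x u) v = row b v" by simp
          then show ?thesis using that(2) by (simp add: row_def)
        qed
        define \<chi>' where "\<chi>' v = \<chi> (b @ v)" for v
        have "\<chi>' ` words ?F n \<subseteq> {..<r}"
          using \<chi> b by (auto simp: \<chi>'_def intro!: words_append)
        from n[OF this] show "(\<exists>w\<in>variable_words ?F (N + n). monochromatic \<chi> ?F w) \<or>
          (\<exists>e\<in>words ?F (N + n). \<exists>K\<subseteq>{..<r}. card K = Suc s \<and>
          (\<forall>c\<in>K. \<exists>w\<in>variable_words ?F (N + n). subst_word z w = e \<and> (\<forall>x\<in>F. \<chi> (subst_word x w) = c)))"
        proof (elim disjE bexE exE conjE)
          fix w assume w: "w \<in> variable_words ?F n" "monochromatic \<chi>' ?F w"
          have "monochromatic \<chi> ?F (map Some b @ w)"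
            using w(2)
            unfolding monochromatic_def \<chi>'_def subst_word_append subst_word_map_Some .
          then show ?thesis using word_append_variable_words[OF b w(1)] by blast
        next
          fix e K
          assume e: "e \<in> words ?F n" and K: "K \<subseteq> {..<r}" "card K = s"
            and l: "\<forall>c\<in>K. \<exists>w\<in>variable_words ?F n. subst_word z w = e \<and> (\<forall>x\<in>F. \<chi>' (subst_word x w) = c)"
          show ?thesis
          proof (cases "\<chi>' e \<in> K")
            \<comment> \<open>The focus already has the colour of one of the lines, so that line
              stays monochromatic when \<open>z\<close> is added.\<close>
            case True
            then obtain w where w: "w \<in> variable_words ?F n" "subst_word z w = e"
              "\<forall>x\<in>F. \<chi>' (subst_word x w) = \<chi>' e" using l by blast
            have "monochromatic \<chi> ?F (map Some b @ w)"
              by (rule monochromaticI[where c = "\<chi>' e"]) (use w(2,3) in \<open>auto simp: \<chi>'_def\<close>)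
            then show ?thesis using word_append_variable_words[OF b w(1)] by blast
          next
            case False
            \<comment> \<open>The focus is extended by putting \<open>z\<close> into
              \<open>u\<close>. Each old line \<open>w\<close> becomes \<open>u @ w\<close>, with
              both variables moving together and its colour kept. The line
              \<open>u @ map Some e\<close> supplies the new colour
              \<open>\<chi>' e\<close>.\<close>
            let ?e = "subst_word z u @ e"
            have "?e \<in> words ?F (N + n)"
              using subst_word_in_words[OF u'] e by (intro words_append) auto
            moreover have "insert (\<chi>' e) K \<subseteq> {..<r}"
              using K(1) \<chi> words_append[OF b e] by (auto simp: \<chi>'_def)
            moreover have "card (insert (\<chi>' e) K) = Suc s"
              using False K finite_subset[OF K(1)] by simp
            moreover have "\<exists>w\<in>variable_words ?F (N + n). subst_word z w = ?e \<and>
                (\<forall>x\<in>F. \<chi> (subst_word x w) = c)" if "c \<in> insert (\<chi>' e) K" for c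
            proof (cases "c = \<chi>' e")
              case True
              then show ?thesis
                using variable_words_append_word[OF u' e] same e
                by (intro bexI[of _ "u @ map Some e"]) (auto simp: \<chi>'_def)
            next
              case False
              then obtain w where w: "w \<in> variable_words ?F n" "subst_word z w = e"
                "\<forall>x\<in>F. \<chi>' (subst_word x w) = c" using l \<open>c \<in> _\<close> by blast
              then show ?thesis
                using variable_words_append[OF u' w(1)] same subst_word_in_words[OF w(1)]
                by (intro bexI[of _ "u @ w"]) (auto simp: \<chi>'_def)
            qed
            ultimately show ?thesis by blast
          qed
        qed
      qed
    qed
    obtain n where n: "\<And>\<chi>. \<chi> ` words ?F n \<subseteq> {..<r} \<Longrightarrow>
        (\<exists>w\<in>variable_words ?F n. monochromatic \<chi> ?F w) \<or>
        (\<exists>e\<in>words ?F n. \<exists>K\<subseteq>{..<r}. card K = r \<and>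
          (\<forall>c\<in>K. \<exists>w\<in>variable_words ?F n. subst_word z w = e \<and> (\<forall>x\<in>F. \<chi> (subst_word x w) = c)))"
      using focus[of r] by blast
    have "\<exists>w\<in>variable_words ?F n. monochromatic \<chi> ?F w" if \<chi>: "\<chi> ` words ?F n \<subseteq> {..<r}" for \<chi>
      using n[OF \<chi>]
    proof (elim disjE bexE exE conjE)
      fix e K
      assume e: "e \<in> words ?F n" and K: "K \<subseteq> {..<r}" "card K = r"
        and l: "\<forall>c\<in>K. \<exists>w\<in>variable_words ?F n. subst_word z w = e \<and> (\<forall>x\<in>F. \<chi> (subst_word x w) = c)"
      have "K = {..<r}" using K by (simp add: card_subset_eq)
      then have "\<chi> e \<in> K" using \<chi> e by blast
      then obtain w where w: "w \<in> variable_words ?F n" "subst_word z w = e"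
        "\<forall>x\<in>F. \<chi> (subst_word x w) = \<chi> e" using l by blast
      have "monochromatic \<chi> ?F w"
        by (rule monochromaticI[where c = "\<chi> e"]) (use w(2,3) in auto)
      then show ?thesis using w(1) by blast
    qed blast
    then show ?thesis by blast
  qed
qed

subsection \<open>Ultrafilters\<close>

definition has_fip :: "'a set set \<Rightarrow> bool" where
  "has_fip M \<longleftrightarrow> (\<forall>X. finite X \<longrightarrow> X \<subseteq> M \<longrightarrow> \<Inter>X \<noteq> {})"

text \<open>By Zorn's lemma there is a maximal family with the finite intersection property above
  \<open>M\<close>; the ultrafilter axioms follow from maximality.\<close>

lemma has_fip_extend_ultrafilter:
  assumes "has_fip M"
  shows "\<exists>q. is_ultrafilter q \<and> M \<subseteq> q"
proof -
  let ?Z = "{N. M \<subseteq> N \<and> has_fip N}"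
  have "\<exists>U\<in>?Z. \<forall>X\<in>?Z. U \<subseteq> X \<longrightarrow> X = U"
  proof (rule subset_Zorn_nonempty)
    show "?Z \<noteq> {}" using assms by blast
    fix \<C> assume "\<C> \<noteq> {}" and "subset.chain ?Z \<C>"
    then have ch: "\<And>N. N \<in> \<C> \<Longrightarrow> M \<subseteq> N \<and> has_fip N"
      and lin: "\<And>N N'. N \<in> \<C> \<Longrightarrow> N' \<in> \<C> \<Longrightarrow> N \<subseteq> N' \<or> N' \<subseteq> N"
      unfolding subset_chain_def by blast+
    have "\<Inter>X \<noteq> {}" if "finite X" "X \<subseteq> \<Union>\<C>" for X
    proof -
      have "\<exists>N\<in>\<C>. X \<subseteq> N" 
        using that
      proof (induction X rule: finite_induct)
        case empty then show ?case using \<open>\<C> \<noteq> {}\<close> by blast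
      next
        case (insert A X)
        then obtain N N' where "N \<in> \<C>" "X \<subseteq> N" "N' \<in> \<C>" "A \<in> N'" by auto
        then show ?case using lin[of N N'] by blast
      qed
      then show ?thesis using ch that(1) unfolding has_fip_def by blast
    qed
    then show "\<Union>\<C> \<in> ?Z" using ch \<open>\<C> \<noteq> {}\<close> unfolding has_fip_def by blast
  qed
  then obtain q where "q \<in> ?Z" and "\<forall>X\<in>?Z. q \<subseteq> X \<longrightarrow> X = q"
    by (rule bexE)
  then have q: "M \<subseteq> q" "has_fip q"
    and max: "\<And>N. M \<subseteq> N \<Longrightarrow> has_fip N \<Longrightarrow> q \<subseteq> N \<Longrightarrow> N = q"
    by auto
  have memI: "A \<in> q" if "has_fip (insert A q)" for A
    using max[of "insert A q"] q(1) that by blast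
  \<comment> \<open>Adjoining \<open>A\<close> keeps the finite intersection property: in a finite
    subfamily, \<open>A\<close> can be replaced by the members of \<open>X\<close>, whose
    intersection lies in \<open>A\<close>.\<close>
  have up: "A \<in> q" if X: "finite X" "X \<subseteq> q" "\<Inter>X \<subseteq> A" for X A
  proof (rule memI, unfold has_fip_def, intro allI impI)
    fix Y assume Y: "finite Y" "Y \<subseteq> insert A q"
    have "\<Inter>((Y - {A}) \<union> X) \<noteq> {}"
      using q(2) X Y unfolding has_fip_def by (metis Diff_subset_conv finite_Diff finite_UnI
        insert_is_Un le_sup_iff)
    then show "\<Inter>Y \<noteq> {}" using X(3) by blast
  qed
  have "is_ultrafilter q"
    unfolding is_ultrafilter_def
  proof (intro conjI allI impI)
    show "UNIV \<in> q" using up[of "{}"] by simp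
    show "{} \<notin> q" 
    proof
      assume "{} \<in> q"
      then have "\<Inter>{{}} \<noteq> ({}::'a set)" using q(2) unfolding has_fip_def by blast
      then show False by simp
    qed
    show "A \<inter> B \<in> q" if "A \<in> q" "B \<in> q" for A B
      using up[of "{A, B}"] that by simp
    show "B \<in> q" if "A \<in> q" "A \<subseteq> B" for A B
      using up[of "{A}"] that by simp
    show "A \<in> q \<or> - A \<in> q" for A
    proof (rule disjCI)
      \<comment> \<open>Since \<open>- A\<close> cannot be adjoined, some finite part of
        \<open>q\<close> has its intersection disjoint from \<open>- A\<close>, that is, inside
        \<open>A\<close>.\<close>
      assume "- A \<notin> q"
      then have "\<not> has_fip (insert (- A) q)" using memI by blast
      then obtain X where X: "finite X" "X \<subseteq> insert (- A) q" "\<Inter>X = {}"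
        unfolding has_fip_def by blast
      show "A \<in> q"
        by (rule up[of "X - {- A}"]) (use X in auto)
    qed
  qed
  then show ?thesis using q(1) by blast
qed

lemma is_ultrafilterD:
  assumes "is_ultrafilter p"
  shows "{} \<notin> p" "UNIV \<in> p" "\<And>A B. A \<in> p \<Longrightarrow> B \<in> p \<Longrightarrow> A \<inter> B \<in> p"
    "\<And>A B. A \<in> p \<Longrightarrow> A \<subseteq> B \<Longrightarrow> B \<in> p" "\<And>A. A \<in> p \<or> - A \<in> p"
  using assms unfolding is_ultrafilter_def by blast+

lemma is_ultrafilter_obtain:
  assumes "is_ultrafilter p" "A \<in> p"
  obtains x where "x \<in> A"
  using is_ultrafilterD(1)[OF assms(1)] assms(2) by (metis ex_in_conv)

lemma is_ultrafilter_INT: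
  assumes "is_ultrafilter p" "finite I" "\<And>i. i \<in> I \<Longrightarrow> A i \<in> p"
  shows "(\<Inter>i\<in>I. A i) \<in> p"
  using assms(2,3) by (induction I rule: finite_induct) (auto intro: is_ultrafilterD[OF assms(1)])

lemma mem_deltaD:
  assumes "p \<in> delta f"
  shows "is_ultrafilter p" "phi f x \<in> p"
  using assms by (auto simp: delta_def beta_closure_def beta_def)

subsection \<open>Products in a commutative partial semigroup\<close>

text \<open>The partial semigroup is made a total monoid on \<^typ>\<open>'a option option\<close>, with
  \<^term>\<open>Some None\<close> standing for undefined and \<^term>\<open>None\<close> for an adjoined unit, so that
  products over finite sets become available.\<close>

definition adj :: "('a \<Rightarrow> 'a \<Rightarrow> 'a option) \<Rightarrow> 'a option option \<Rightarrow> 'a option option \<Rightarrow> 'a option option"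
  where "adj f u v = (case u of None \<Rightarrow> v | Some x \<Rightarrow> (case v of None \<Rightarrow> u | Some y \<Rightarrow> Some (pmult f x y)))"

lemma pmult_eq_Some: "pmult f u v = Some z \<longleftrightarrow> (\<exists>x y. u = Some x \<and> v = Some y \<and> f x y = Some z)"
  by (auto simp: pmult_def bind_eq_Some_conv)

lemma pmult_Some [simp]: "pmult f (Some x) (Some y) = f x y"
  by (simp add: pmult_def)

locale comm_partial_semigroup =
  fixes f :: "'a \<Rightarrow> 'a \<Rightarrow> 'a option"
  assumes assoc: "partial_semigroup f" and comm: "partial_commutative f"
begin

sublocale pm: abel_semigroup "pmult f"
proof
  show "pmult f (pmult f u v) w = pmult f u (pmult f v w)" for u v w
    using assoc unfolding partial_semigroup_def
    by (cases u; cases v; cases w) (auto simp: pmult_def)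
  show "pmult f u v = pmult f v u" for u v
    using comm unfolding partial_commutative_def
    by (cases u; cases v) (auto simp: pmult_def)
qed

sublocale pr: comm_monoid_set "adj f" None
proof
  show "adj f (adj f u v) w = adj f u (adj f v w)" for u v w
    by (auto simp: adj_def pm.assoc split: option.split)
  show "adj f u v = adj f v u" for u v
    by (auto simp: adj_def pm.commute split: option.split)
  show "adj f u None = u" for u
    by (auto simp: adj_def split: option.split)
qed

lemma adj_Some [simp]: "adj f (Some u) (Some v) = Some (pmult f u v)"
  by (simp add: adj_def)

lemma Some_plist: "us \<noteq> [] \<Longrightarrow> Some (plist f us) = foldr (adj f) (map Some us) None"
proof (induction us rule: induct_list012)
  case (3 u v us)
  then show ?case by (metis adj_Some foldr.simps(2) list.discI list.map(2) o_apply plist.simps(3))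
qed (auto simp: adj_def)

text \<open>Passing to the commutative monoid makes products splittable and reindexable without
  regard to the order of indices. For empty \<open>H\<close> the right side would be the adjoined
  unit, which is not of the form \<open>Some _\<close>.\<close>

lemma Some_pprod:
  assumes "finite H" "H \<noteq> {}"
  shows "Some (pprod f u H) = pr.F (\<lambda>i. Some (u i)) H"
proof -
  have *: "pr.F h (set xs) = foldr (adj f) (map h xs) None" if "distinct xs" for h and xs :: "nat list"
    using that by (induction xs) auto
  show ?thesis
    using *[of "sorted_list_of_set H" "\<lambda>i. Some (u i)"] assms
    by (auto simp: pprod_def Some_plist comp_def simp del: foldr_map)
qed

subsection \<open>J-sets\<close>

definition J_set :: "'a set \<Rightarrow> bool" where
  "J_set A \<longleftrightarrow> (\<forall>F\<in>finite_subsets {y. adequate_seq f y}. \<forall>m. \<exists>a H. H \<in> finite_subsets UNIV \<and>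
     H \<subseteq> {m..} \<and> (\<forall>y\<in>F. \<exists>c\<in>A. pmult f (Some a) (seq_prod f y H) = Some c))"

lemma J_setE:
  assumes "J_set A" and "F \<in> finite_subsets {y. adequate_seq f y}"
  obtains H c a where "H \<in> finite_subsets UNIV" "H \<subseteq> {m..}"
    "\<forall>y\<in>F. c y \<in> A" "\<forall>y\<in>F. pmult f (Some a) (seq_prod f y H) = Some (c y)"
proof -
  obtain a H where H: "H \<in> finite_subsets UNIV" "H \<subseteq> {m..}"
    and ex: "\<forall>y\<in>F. \<exists>c. c \<in> A \<and> pmult f (Some a) (seq_prod f y H) = Some c"
    using assms(1)[unfolded J_set_def, rule_format, OF assms(2), of m] by blast
  from bchoice[OF ex] obtain c
    where "\<forall>y\<in>F. c y \<in> A \<and> pmult f (Some a) (seq_prod f y H) = Some (c y)"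
    by blast
  with H show thesis using that by blast
qed

section \<open>Hales-Jewett applied to products of adequate sequences\<close>

lemma adequate_seq_eventually:
  assumes "adequate_seq f y" "finite K"
  shows "\<exists>m. \<forall>n\<ge>m. y n \<in> sigma f K"
proof (cases "K = {}")
  case False
  then have "K \<in> finite_subsets UNIV" using assms(2) by (simp add: finite_subsets_def)
  then obtain m where m: "{the (seq_prod f y F) | F. F \<in> finite_subsets UNIV \<and> m \<le> Min F} \<subseteq> sigma f K"
    using assms(1) unfolding adequate_seq_def by blast
  have "y n \<in> sigma f K" if "n \<ge> m" for n
  proof -
    \<comment> \<open>The adequacy condition is used for the one-element index set
      \<open>{n}\<close>.\<close>
    have "the (seq_prod f y {n}) \<in> sigma f K"
      by (rule subsetD[OF m], rule CollectI, rule exI[of _ "{n}"])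
        (use that in \<open>simp add: finite_subsets_def\<close>)
    then show ?thesis by (simp add: pprod_def)
  qed
  then show ?thesis by blast
qed (simp add: sigma_def)

lemma adequate_seqs_eventually:
  assumes "finite F" "F \<subseteq> {y. adequate_seq f y}" "finite K"
  shows "\<exists>m. \<forall>n\<ge>m. \<forall>y\<in>F. y n \<in> sigma f K"
  using assms(1,2)
proof (induction F rule: finite_induct)
  case (insert y F)
  then obtain m m' where "\<forall>n\<ge>m. \<forall>y\<in>F. y n \<in> sigma f K" "\<forall>n\<ge>m'. y n \<in> sigma f K"
    using adequate_seq_eventually[OF _ assms(3), of y] by auto
  then show ?case by (intro exI[of _ "max m m'"]) auto
qed auto

text \<open>The times \<open>t i\<close> are chosen one after another, each so late that every
  letter of \<open>F\<close> can be multiplied onto all products formed so far. Only finitely many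
  products arise at each stage; \<open>P\<close> records them so that adequacy can be applied
  again.\<close>

lemma mixed_products:
  assumes F: "finite F" "F \<subseteq> {y. adequate_seq f y}" and L: "finite L" "a \<in> sigma f L"
  shows "\<exists>t P. strict_mono_on {..<n::nat} t \<and> (\<forall>i<n. m \<le> t i) \<and> finite P \<and> P \<subseteq> sigma f L \<and>
    (\<forall>v. (\<forall>i<n. v i \<in> F) \<longrightarrow>
      (\<exists>x\<in>P. adj f (Some (Some a)) (pr.F (\<lambda>i. Some (Some (v i (t i)))) {..<n}) = Some (Some x)))"
proof (induction n)
  case 0
  show ?case using L by (intro exI[of _ id] exI[of _ "{a}"]) (auto simp: strict_mono_on_def)
next
  case (Suc n)
  then obtain t P where t: "strict_mono_on {..<n} t" "\<forall>i<n. m \<le> t i"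
    and P: "finite P" "P \<subseteq> sigma f L"
    and v: "\<And>v. (\<forall>i<n. v i \<in> F) \<Longrightarrow>
      \<exists>x\<in>P. adj f (Some (Some a)) (pr.F (\<lambda>i. Some (Some (v i (t i)))) {..<n}) = Some (Some x)"
    by blast
  \<comment> \<open>The elements of \<open>P\<close> make \<open>x * y j\<close> defined. The
    elements \<open>l * x\<close> make \<open>l * (x * y j)\<close> defined by associativity, so the
    new products stay in \<open>sigma f L\<close>.\<close>
  define K where "K = P \<union> (\<lambda>(l, x). the (f l x)) ` (L \<times> P)"
  have finK: "finite K" using P L by (auto simp: K_def)
  obtain k where k: "\<And>j y. j \<ge> k \<Longrightarrow> y \<in> F \<Longrightarrow> y j \<in> sigma f K"
    using adequate_seqs_eventually[OF F finK] by blast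
  \<comment> \<open>The sum bounds every earlier time, so \<open>j\<close> lies beyond all of them
    as well as being at least \<open>k\<close> and \<open>m\<close>.\<close>
  define j where "j = k + m + Suc (\<Sum>i<n. t i)"
  have j: "j \<ge> k" "j \<ge> m" by (simp_all add: j_def)
  have tj: "t i < j" if "i < n" for i
    using member_le_sum[of i "{..<n}" t] that by (simp add: j_def)
  define t' where "t' = t(n := j)"
  define P' where "P' = (\<lambda>(x, y). the (f x (y j))) ` (P \<times> F)"
  have xy: "\<exists>z. f x (y j) = Some z \<and> z \<in> sigma f L \<and> z \<in> P'" if "x \<in> P" "y \<in> F" for x y
  proof -
    have "y j \<in> phi f x" using k[OF j(1) that(2)] that(1) by (auto simp: sigma_def K_def)
    then obtain z where z: "f x (y j) = Some z" by (auto simp: phi_def)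
    have "z \<in> phi f l" if l: "l \<in> L" for l
    proof -
      have "x \<in> phi f l" using P(2) \<open>x \<in> P\<close> l by (auto simp: sigma_def)
      then obtain w where w: "f l x = Some w" by (auto simp: phi_def)
      have "w = (\<lambda>(l, x). the (f l x)) (l, x)" using w by simp
      then have "w \<in> K" unfolding K_def using \<open>x \<in> P\<close> l by blast
      then have "f w (y j) \<noteq> None"
        using k[OF j(1) \<open>y \<in> F\<close>] by (auto simp: sigma_def phi_def)
      moreover have "f w (y j) = f l z"
        using pm.assoc[of "Some l" "Some x" "Some (y j)"] w z by simp
      ultimately show ?thesis by (simp add: phi_def)
    qed
    moreover have "z \<in> P'" unfolding P'_def using that z by force
    ultimately show ?thesis using z by (auto simp: sigma_def)
  qed
  have "strict_mono_on {..<Suc n} t'"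
    using t(1) tj by (auto simp: strict_mono_on_def t'_def less_Suc_eq)
  moreover have "\<forall>i<Suc n. m \<le> t' i" using t(2) j(2) by (auto simp: t'_def)
  moreover have "finite P'" using P F by (auto simp: P'_def)
  moreover have "P' \<subseteq> sigma f L" using xy by (fastforce simp: P'_def)
  moreover have "\<exists>x\<in>P'. adj f (Some (Some a)) (pr.F (\<lambda>i. Some (Some (v' i (t' i)))) {..<Suc n})
      = Some (Some x)" if v': "\<forall>i<Suc n. v' i \<in> F" for v'
  proof -
    obtain x where x: "x \<in> P"
      "adj f (Some (Some a)) (pr.F (\<lambda>i. Some (Some (v' i (t i)))) {..<n}) = Some (Some x)"
      using v[of v'] v' by auto
    have "pr.F (\<lambda>i. Some (Some (v' i (t' i)))) {..<n} = pr.F (\<lambda>i. Some (Some (v' i (t i)))) {..<n}"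
      by (intro pr.cong) (auto simp: t'_def)
    then have "pr.F (\<lambda>i. Some (Some (v' i (t' i)))) {..<Suc n}
        = adj f (pr.F (\<lambda>i. Some (Some (v' i (t i)))) {..<n}) (Some (Some (v' n j)))"
      by (simp add: lessThan_Suc t'_def pr.commute)
    then have "adj f (Some (Some a)) (pr.F (\<lambda>i. Some (Some (v' i (t' i)))) {..<Suc n})
        = adj f (Some (Some x)) (Some (Some (v' n j)))"
      by (simp only: pr.assoc[symmetric] x(2))
    then show ?thesis using xy[OF x(1), of "v' n"] v' by auto
  qed
  ultimately show ?case by blast
qed

text \<open>The factor \<open>a\<close> guarantees that the part of a product coming from the fixed letters
  of a variable word is an element of the semigroup even if there are no fixed letters.\<close>

lemma sigma_not_covered:
  assumes "adequate f" and "finite L" and "finite \<A>" and "\<And>A. A \<in> \<A> \<Longrightarrow> \<not> J_set A"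
  shows "\<not> sigma f L \<subseteq> \<Union>\<A>"
proof
  assume cov: "sigma f L \<subseteq> \<Union>\<A>"
  \<comment> \<open>Adequacy speaks of nonempty sets only; the extra element covers
    \<open>L = {}\<close>.\<close>
  have "insert undefined L \<in> finite_subsets UNIV" using assms(2) by (simp add: finite_subsets_def)
  then have "sigma f (insert undefined L) \<noteq> {}" using assms(1) unfolding adequate_def by blast
  then obtain a where a: "a \<in> sigma f L" by (auto simp: sigma_def)
  have "\<forall>A\<in>\<A>. \<exists>F m. F \<in> finite_subsets {y. adequate_seq f y} \<and>
    \<not> (\<exists>a H. H \<in> finite_subsets UNIV \<and>
     H \<subseteq> {m..} \<and> (\<forall>y\<in>F. \<exists>c\<in>A. pmult f (Some a) (seq_prod f y H) = Some c))"
  proof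
    fix A assume "A \<in> \<A>"
    from assms(4)[OF this] show "\<exists>F m. F \<in> finite_subsets {y. adequate_seq f y} \<and>
      \<not> (\<exists>a H. H \<in> finite_subsets UNIV \<and>
       H \<subseteq> {m..} \<and> (\<forall>y\<in>F. \<exists>c\<in>A. pmult f (Some a) (seq_prod f y H) = Some c))"
      unfolding J_set_def by blast
  qed
  then obtain FF mm where FF: "\<And>A. A \<in> \<A> \<Longrightarrow> FF A \<in> finite_subsets {y. adequate_seq f y}"
    and bad: "\<And>A a H. A \<in> \<A> \<Longrightarrow> H \<in> finite_subsets UNIV \<Longrightarrow> H \<subseteq> {mm A..} \<Longrightarrow>
      (\<forall>y\<in>FF A. \<exists>c\<in>A. pmult f (Some a) (seq_prod f y H) = Some c) \<Longrightarrow> False"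
    by metis
  \<comment> \<open>It is not known in advance which set of the cover will contain the monochromatic
    line, so the counterexamples \<open>FF A\<close> are pooled into one alphabet and
    \<open>m\<close> dominates all the bounds \<open>mm A\<close>.\<close>
  define F where "F = (\<Union>A\<in>\<A>. FF A)"
  have F: "finite F" "F \<subseteq> {y. adequate_seq f y}"
    using FF assms(3) by (auto simp: F_def finite_subsets_def)
  define m where "m = Max (insert 0 (mm ` \<A>))"
  have m: "mm A \<le> m" if "A \<in> \<A>" for A
    unfolding m_def using that assms(3) by (intro Max_ge) auto
  obtain r and col :: "'a set \<Rightarrow> nat" where col: "col ` \<A> = {i. i < r}" "inj_on col \<A>"
    using finite_imp_inj_to_nat_seg[OF assms(3)] by blast
  obtain n where n: "\<And>\<chi>. \<chi> ` words F n \<subseteq> {..<r} \<Longrightarrow> \<exists>w\<in>variable_words F n. monochromatic \<chi> F w"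
    using hales_jewett[OF F(1)] by blast
  obtain t P where t: "strict_mono_on {..<n} t" "\<forall>i<n. m \<le> t i"
    and P: "P \<subseteq> sigma f L"
    and v: "\<And>v. (\<forall>i<n. v i \<in> F) \<Longrightarrow>
      \<exists>x\<in>P. adj f (Some (Some a)) (pr.F (\<lambda>i. Some (Some (v i (t i)))) {..<n}) = Some (Some x)"
    using mixed_products[OF F assms(2) a, where n = n and m = m] by auto
  \<comment> \<open>The letters are sequences: the letter at position \<open>i\<close> contributes
    its term at time \<open>t i\<close>. A word is then coloured by a set of the cover containing
    its value.\<close>
  define val where "val w = adj f (Some (Some a)) (pr.F (\<lambda>i. Some (Some ((w ! i) (t i)))) {..<n})" for w
  have "\<exists>A. A \<in> \<A> \<and> (\<exists>x\<in>A. val w = Some (Some x))" if "w \<in> words F n" for w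
  proof -
    have "\<forall>i<n. w ! i \<in> F" using that by (auto simp: words_def)
    from v[OF this] show ?thesis using P cov unfolding val_def by blast
  qed
  then obtain cell where cell: "\<And>w. w \<in> words F n \<Longrightarrow> cell w \<in> \<A>"
    "\<And>w. w \<in> words F n \<Longrightarrow> \<exists>x\<in>cell w. val w = Some (Some x)" by metis
  have "col A < r" if "A \<in> \<A>" for A using col(1) that by blast
  then have "(col \<circ> cell) ` words F n \<subseteq> {..<r}" using cell(1) by auto
  then obtain w where w: "w \<in> variable_words F n" "monochromatic (col \<circ> cell) F w"
    using n by blast
  obtain A where A: "A \<in> \<A>" "\<And>y. y \<in> F \<Longrightarrow> cell (subst_word y w) = A"
  proof (cases "F = {}")
    case True
    have "\<A> \<noteq> {}" using cov a by auto
    then show ?thesis using that True by blast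
  next
    case False
    then obtain y0 where y0: "y0 \<in> F" by blast
    have "cell (subst_word y w) = cell (subst_word y0 w)" if "y \<in> F" for y
    proof (rule inj_onD[OF col(2)])
      show "col (cell (subst_word y w)) = col (cell (subst_word y0 w))"
        using w(2) that y0 unfolding monochromatic_def comp_def by blast
    qed (use cell(1) subst_word_in_words[OF w(1)] that y0 in auto)
    then show ?thesis using that cell(1) subst_word_in_words[OF w(1) y0] y0 by blast
  qed
  have len: "length w = n" using w(1) by (simp add: variable_words_def)
  \<comment> \<open>The variable positions give the index set \<open>H\<close>, which is nonempty
    since a variable word contains its variable. The fixed letters and \<open>a\<close> combine into
    \<open>B\<close>, independent of the letter substituted, so each value on the line is
    \<open>B\<close> times the product of \<open>y\<close> over \<open>H\<close>.\<close>
  define V where "V = {i. i < n \<and> w ! i = None}"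
  have V: "V \<noteq> {}" "V \<subseteq> {..<n}" "finite V"
    using w(1) by (auto simp: variable_words_def V_def in_set_conv_nth)
  define H where "H = t ` V"
  have inj: "inj_on t V" using t(1) V(2) by (meson strict_mono_on_imp_inj_on inj_on_subset)
  have H: "H \<in> finite_subsets UNIV" "H \<subseteq> {mm A..}"
    using V t(2) m[OF A(1)] by (force simp: H_def finite_subsets_def)+
  define B where "B = adj f (Some (Some a)) (pr.F (\<lambda>i. Some (Some (the (w ! i) (t i)))) ({..<n} - V))"
  have split: "val (subst_word y w) = adj f B (Some (seq_prod f y H))" for y
  proof -
    have 1: "pr.F (\<lambda>i. Some (Some ((subst_word y w ! i) (t i)))) ({..<n} - V)
        = pr.F (\<lambda>i. Some (Some (the (w ! i) (t i)))) ({..<n} - V)"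
      by (intro pr.cong) (auto simp: V_def subst_word_def len split: option.split)
    have "pr.F (\<lambda>i. Some (Some ((subst_word y w ! i) (t i)))) V = pr.F (\<lambda>i. Some (Some (y (t i)))) V"
      by (intro pr.cong) (auto simp: V_def subst_word_def len split: option.split)
    also have "\<dots> = pr.F (\<lambda>i. Some (Some (y i))) H"
      unfolding H_def by (simp add: pr.reindex[OF inj] comp_def)
    also have "\<dots> = Some (seq_prod f y H)"
      using H(1) by (subst Some_pprod) (auto simp: finite_subsets_def)
    finally have 2: "pr.F (\<lambda>i. Some (Some ((subst_word y w ! i) (t i)))) V = Some (seq_prod f y H)" .
    show ?thesis
      unfolding val_def B_def pr.subset_diff[OF V(2) finite_lessThan] 1 2 by (simp add: pr.assoc)
  qed
  obtain B' where B': "B = Some B'"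
    unfolding B_def by (cases "pr.F (\<lambda>i. Some (Some (the (w ! i) (t i)))) ({..<n} - V)") (auto simp: adj_def)
  have B'': "\<exists>c\<in>A. pmult f B' (seq_prod f y H) = Some c" if "y \<in> F" for y
    using cell(2)[OF subst_word_in_words[OF w(1) that]] A(2)[OF that] split[of y] by (auto simp: B')
  \<comment> \<open>A single member of \<open>FF A\<close> suffices to show that \<open>B'\<close>
    is defined, since its product with \<open>B'\<close> is.\<close>
  obtain y0 where "y0 \<in> FF A" using FF[OF A(1)] by (auto simp: finite_subsets_def)
  then have "y0 \<in> F" using A(1) by (auto simp: F_def)
  then obtain b where "B' = Some b" using B'' by (auto simp: pmult_eq_Some)
  then show False
    using bad[OF A(1) H, of b] B'' A(1) by (auto simp: F_def)
qed

section \<open>The ideal of ultrafilters consisting of J-sets\<close>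

definition J_ultrafilters :: "'a set set set" where
  "J_ultrafilters = {q \<in> delta f. \<forall>A\<in>q. J_set A}"

text \<open>The sets \<open>phi f x\<close> and the complements of all sets that are not J-sets have
  the finite intersection property: this is what \<open>sigma_not_covered\<close> says. An
  ultrafilter extending them is as required.\<close>

lemma J_ultrafilters_nonempty:
  assumes "adequate f"
  shows "J_ultrafilters \<noteq> {}"
proof -
  let ?M = "range (phi f) \<union> uminus ` {A. \<not> J_set A}"
  have "has_fip ?M"
    unfolding has_fip_def
  proof (intro allI impI)
    fix X assume X: "finite X" "X \<subseteq> ?M"
    have "finite (X \<inter> range (phi f))" using X(1) by simp
    then obtain L where L: "finite L" "X \<inter> range (phi f) = phi f ` L"
      by (metis finite_subset_image inf.cobounded2)
    define \<A> where "\<A> = uminus ` X \<inter> {A. \<not> J_set A}"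
    have "\<not> sigma f L \<subseteq> \<Union>\<A>"
      using assms L(1) X(1) by (intro sigma_not_covered) (auto simp: \<A>_def)
    then obtain x where x: "x \<in> sigma f L" "x \<notin> \<Union>\<A>" by blast
    have "x \<in> B" if B: "B \<in> X" for B
    proof (cases "B \<in> range (phi f)")
      case True
      then have "B \<in> phi f ` L" using B L(2) by blast
      then show ?thesis using x(1) by (auto simp: sigma_def)
    next
      case False
      then have "- B \<in> \<A>" using B X(2) by (auto simp: \<A>_def)
      then show ?thesis using x(2) by blast
    qed
    then show "\<Inter>X \<noteq> {}" by blast
  qed
  then obtain q where q: "is_ultrafilter q" "?M \<subseteq> q" using has_fip_extend_ultrafilter by blast
  have "J_set A" if "A \<in> q" for A
  proof (rule ccontr)
    assume "\<not> J_set A"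
    then have "- A \<in> q" using q(2) by blast
    then have "A \<inter> - A \<in> q" using is_ultrafilterD(3)[OF q(1) that] by blast
    then show False using is_ultrafilterD(1)[OF q(1)] by simp
  qed
  moreover have "q \<in> delta f" using q by (auto simp: delta_def beta_closure_def beta_def)
  ultimately show ?thesis by (auto simp: J_ultrafilters_def)
qed

lemma left_quotient_iff: "t \<in> left_quotient f a A \<longleftrightarrow> (\<exists>c\<in>A. f a t = Some c)"
  by (auto simp: left_quotient_def phi_def)

text \<open>In either product, the factor \<open>u\<close> can be absorbed into the element
  \<open>a\<close> of the J-set condition: a point chosen by \<open>u\<close> multiplies all the
  finitely many products into \<open>A\<close> at once. For \<open>q * u\<close> that point arises
  on the right and is moved next to \<open>a\<close> by commutativity.\<close>

lemma J_ultrafilters_ideal: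
  assumes "adequate f"
  shows "two_sided_ideal (ultra_mult f) (delta f) J_ultrafilters"
  unfolding two_sided_ideal_def
proof (intro conjI ballI)
  show "J_ultrafilters \<noteq> {}" using J_ultrafilters_nonempty[OF assms] .
  show "J_ultrafilters \<subseteq> delta f" by (auto simp: J_ultrafilters_def)
  fix q u assume q: "q \<in> J_ultrafilters" and u: "u \<in> delta f"
  have q': "q \<in> delta f" "\<And>A. A \<in> q \<Longrightarrow> J_set A" using q by (auto simp: J_ultrafilters_def)
  have "J_set A" if A: "A \<in> ultra_mult f q u" for A
    unfolding J_set_def
  proof (intro ballI allI)
    fix F m assume F: "F \<in> finite_subsets {y. adequate_seq f y}"
    have "J_set {a. left_quotient f a A \<in> u}" using A q'(2) by (simp add: ultra_mult_def)
    then obtain H c a where H: "H \<in> finite_subsets UNIV" "H \<subseteq> {m..}"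
      and "\<forall>y\<in>F. c y \<in> {a. left_quotient f a A \<in> u}"
      and c2: "\<forall>y\<in>F. pmult f (Some a) (seq_prod f y H) = Some (c y)"
      by (rule J_setE[OF _ F, where m = m])
    then have c1: "\<And>y. y \<in> F \<Longrightarrow> left_quotient f (c y) A \<in> u" by simp
    \<comment> \<open>The set \<open>phi f a\<close> is included so that the new multiplier
      \<open>a * s\<close> is defined.\<close>
    have "phi f a \<inter> (\<Inter>y\<in>F. left_quotient f (c y) A) \<in> u"
      using mem_deltaD[OF u] c1 F
      by (intro is_ultrafilterD(3) is_ultrafilter_INT) (auto simp: finite_subsets_def)
    then obtain s where "s \<in> phi f a \<inter> (\<Inter>y\<in>F. left_quotient f (c y) A)"
      by (rule is_ultrafilter_obtain[OF mem_deltaD(1)[OF u]])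
    then have s: "s \<in> phi f a" "\<And>y. y \<in> F \<Longrightarrow> s \<in> left_quotient f (c y) A" by auto
    obtain b where b: "f a s = Some b" using s(1) by (auto simp: phi_def)
    have "\<exists>d\<in>A. pmult f (Some b) (seq_prod f y H) = Some d" if "y \<in> F" for y
    proof -
      have "pmult f (Some b) (seq_prod f y H) = pmult f (pmult f (Some a) (seq_prod f y H)) (Some s)"
        using b by (metis pmult_Some pm.assoc pm.commute)
      then show ?thesis using bspec[OF c2 that] s(2)[OF that] by (auto simp: left_quotient_iff)
    qed
    then show "\<exists>a H. H \<in> finite_subsets UNIV \<and> H \<subseteq> {m..} \<and>
      (\<forall>y\<in>F. \<exists>c\<in>A. pmult f (Some a) (seq_prod f y H) = Some c)" using H by blast
  qed
  then show "ultra_mult f q u \<in> J_ultrafilters"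
    using ultra_mult_in_delta[OF assoc q'(1) u] by (auto simp: J_ultrafilters_def)
  have "J_set A" if A: "A \<in> ultra_mult f u q" for A
    unfolding J_set_def
  proof (intro ballI allI)
    fix F m assume F: "F \<in> finite_subsets {y. adequate_seq f y}"
    have "{a. left_quotient f a A \<in> q} \<in> u" using A by (simp add: ultra_mult_def)
    then obtain a where "a \<in> {a. left_quotient f a A \<in> q}"
      by (rule is_ultrafilter_obtain[OF mem_deltaD(1)[OF u]])
    then have "J_set (left_quotient f a A)" using q'(2) by blast
    then obtain H c b where H: "H \<in> finite_subsets UNIV" "H \<subseteq> {m..}"
      and c: "\<forall>y\<in>F. c y \<in> left_quotient f a A"
        "\<forall>y\<in>F. pmult f (Some b) (seq_prod f y H) = Some (c y)"
      by (rule J_setE[OF _ F, where m = m])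
    have ab: "\<exists>d\<in>A. pmult f (f a b) (seq_prod f y H) = Some d" if "y \<in> F" for y
    proof -
      have "pmult f (f a b) (seq_prod f y H) = pmult f (Some a) (pmult f (Some b) (seq_prod f y H))"
        by (metis pmult_Some pm.assoc)
      then show ?thesis using bspec[OF c(1) that] bspec[OF c(2) that] by (auto simp: left_quotient_iff)
    qed
    \<comment> \<open>Since \<open>F\<close> is nonempty, some product involving
      \<open>a * b\<close> is defined, hence so is \<open>a * b\<close>.\<close>
    moreover obtain d where "f a b = Some d"
      using F ab by (fastforce simp: finite_subsets_def pmult_eq_Some)
    ultimately show "\<exists>a H. H \<in> finite_subsets UNIV \<and> H \<subseteq> {m..} \<and>
      (\<forall>y\<in>F. \<exists>c\<in>A. pmult f (Some a) (seq_prod f y H) = Some c)" using H by metis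
  qed
  then show "ultra_mult f u q \<in> J_ultrafilters"
    using ultra_mult_in_delta[OF assoc u q'(1)] by (auto simp: J_ultrafilters_def)
qed

subsection \<open>The recursion\<close>

text \<open>For idempotent \<open>p\<close> this is the usual star of \<open>C\<close>: the points
  of \<open>C\<close> that can be continued inside \<open>C\<close> by \<open>p\<close>-many
  factors. By \<open>left_quotient_star_mem\<close> such continuations can again be taken in the
  star.\<close>

definition star :: "'a set set \<Rightarrow> 'a set \<Rightarrow> 'a set" where
  "star p C = {x \<in> C. left_quotient f x C \<in> p}"

lemma star_mem:
  assumes "p \<in> delta f" "ultra_mult f p p = p" "C \<in> p"
  shows "star p C \<in> p"
proof -
  have "{x. left_quotient f x C \<in> p} \<in> p" using assms(2,3) by (auto simp: ultra_mult_def)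
  then have "C \<inter> {x. left_quotient f x C \<in> p} \<in> p"
    using is_ultrafilterD(3)[OF mem_deltaD(1)[OF assms(1)]] assms(3) by blast
  then show ?thesis by (simp add: star_def Int_def)
qed

text \<open>The quotient of \<open>C\<close> by \<open>x\<close> is itself in \<open>p\<close>,
  hence so is its star. For \<open>t\<close> in that star, dividing by \<open>x\<close> and then by
  \<open>t\<close> is dividing by \<open>x * t\<close>, which puts \<open>x * t\<close> into the
  star of \<open>C\<close>.\<close>

lemma left_quotient_star_mem:
  assumes p: "p \<in> delta f" "ultra_mult f p p = p" and x: "x \<in> star p C"
  shows "left_quotient f x (star p C) \<in> p"
proof -
  have xC: "left_quotient f x C \<in> p" using x by (simp add: star_def)
  then have "star p (left_quotient f x C) \<in> p" by (rule star_mem[OF p])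
  moreover have "star p (left_quotient f x C) \<subseteq> left_quotient f x (star p C)"
  proof
    fix t assume t: "t \<in> star p (left_quotient f x C)"
    then obtain c where c: "c \<in> C" "f x t = Some c" by (auto simp: star_def left_quotient_iff)
    then have "left_quotient f c C \<in> p"
      using t left_quotient_left_quotient[OF assoc, of t x c C] comm
      left_quotient_left_quotient[OF assoc, of x t c C]
      by (auto simp: star_def partial_commutative_def)
    then show "t \<in> left_quotient f x (star p C)" using c by (auto simp: left_quotient_iff star_def)
  qed
  ultimately show ?thesis using is_ultrafilterD(4)[OF mem_deltaD(1)[OF p(1)]] by blast
qed

text \<open>The star and its quotients by the finitely many \<open>x \<in> M\<close> meet in a
  member of \<open>p\<close>, hence in a J-set. \<open>X\<close> holds the new products and their
  multiples by \<open>M\<close>; its finiteness allows the step to be repeated.\<close>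

lemma J_set_step:
  assumes p: "p \<in> J_ultrafilters" "ultra_mult f p p = p" and C: "C \<in> p"
    and G: "G \<in> finite_subsets {y. adequate_seq f y}"
    and M: "finite M" "M \<subseteq> star p C"
  shows "\<exists>a H X. H \<in> finite_subsets UNIV \<and> H \<subseteq> {m..} \<and> finite X \<and> X \<subseteq> star p C \<and>
    (\<forall>y\<in>G. \<exists>c\<in>X. pmult f (Some a) (seq_prod f y H) = Some c) \<and>
    (\<forall>x\<in>M. \<forall>y\<in>G. \<exists>c\<in>X. pmult f (Some x) (pmult f (Some a) (seq_prod f y H)) = Some c)"
proof -
  have p': "p \<in> delta f" "\<And>A. A \<in> p \<Longrightarrow> J_set A" using p(1) by (auto simp: J_ultrafilters_def)
  have finG: "finite G" using G by (simp add: finite_subsets_def)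
  define A where "A = star p C \<inter> (\<Inter>x\<in>M. left_quotient f x (star p C))"
  have "A \<in> p"
    unfolding A_def using star_mem[OF p'(1) p(2) C] left_quotient_star_mem[OF p'(1) p(2)] M
    by (intro is_ultrafilterD(3) is_ultrafilter_INT) (auto intro: mem_deltaD(1)[OF p'(1)])
  then have "J_set A" by (rule p'(2))
  then obtain H c a where H: "H \<in> finite_subsets UNIV" "H \<subseteq> {m..}"
    and c: "\<forall>y\<in>G. c y \<in> A"
      "\<forall>y\<in>G. pmult f (Some a) (seq_prod f y H) = Some (c y)"
    by (rule J_setE[OF _ G, where m = m])
  have "\<exists>d\<in>star p C. f x (c y) = Some d" if "x \<in> M" "y \<in> G" for x y
    using bspec[OF c(1) that(2)] that(1) by (auto simp: A_def left_quotient_iff)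
  then obtain d where d: "\<And>x y. x \<in> M \<Longrightarrow> y \<in> G \<Longrightarrow> d x y \<in> star p C"
    "\<And>x y. x \<in> M \<Longrightarrow> y \<in> G \<Longrightarrow> f x (c y) = Some (d x y)" by metis
  define X where "X = c ` G \<union> case_prod d ` (M \<times> G)"
  have "finite X" using finG M(1) by (simp add: X_def)
  moreover have "X \<subseteq> star p C" using c(1) d(1) by (auto simp: X_def A_def)
  moreover have "\<forall>y\<in>G. \<exists>c\<in>X. pmult f (Some a) (seq_prod f y H) = Some c"
    using c(2) by (auto simp: X_def)
  moreover have "\<forall>x\<in>M. \<forall>y\<in>G. \<exists>c\<in>X. pmult f (Some x) (pmult f (Some a) (seq_prod f y H)) = Some c"
    using c(2) d(2) by (fastforce simp: X_def)
  ultimately show ?thesis using H by blast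
qed

text \<open>The set \<open>X G\<close> collects the products over all chains that end in \<open>G\<close>; carrying
  it along makes the recursion on \<open>G\<close> depend only on proper subsets of \<open>G\<close>.\<close>

lemma central_recursion:
  assumes p: "p \<in> J_ultrafilters" "ultra_mult f p p = p" and C: "C \<in> p"
    and \<T>: "\<T> = {y. adequate_seq f y}"
  shows "\<exists>\<alpha> H X. \<forall>G\<in>finite_subsets \<T>. H G \<in> finite_subsets UNIV \<and> X G \<subseteq> C \<and>
    (\<forall>y\<in>G. \<exists>c\<in>X G. pmult f (Some (\<alpha> G)) (seq_prod f y (H G)) = Some c) \<and>
    (\<forall>F\<in>finite_subsets \<T>. F \<subset> G \<longrightarrow> (\<forall>i\<in>H F. \<forall>j\<in>H G. i < j) \<and>
      (\<forall>x\<in>X F. \<forall>y\<in>G. \<exists>c\<in>X G. pmult f (Some x) (pmult f (Some (\<alpha> G)) (seq_prod f y (H G))) = Some c))"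
proof -
  \<comment> \<open>\<open>P \<Phi> G r\<close> specifies the triple \<open>r\<close> at
    \<open>G\<close> and consults \<open>\<Phi>\<close> at proper subsets of \<open>G\<close> only,
    as well-founded dependent choice demands.\<close>
  define P where "P \<Phi> G r \<longleftrightarrow> (G \<in> finite_subsets \<T> \<longrightarrow> (case r of (a, H, X) \<Rightarrow>
    H \<in> finite_subsets UNIV \<and> finite X \<and> X \<subseteq> star p C \<and>
    (\<forall>y\<in>G. \<exists>c\<in>X. pmult f (Some a) (seq_prod f y H) = Some c) \<and>
    (\<forall>F\<in>finite_subsets \<T>. F \<subset> G \<longrightarrow> (\<forall>i\<in>fst (snd (\<Phi> F)). \<forall>j\<in>H. i < j) \<and>
      (\<forall>x\<in>snd (snd (\<Phi> F)). \<forall>y\<in>G. \<exists>c\<in>X. pmult f (Some x) (pmult f (Some a) (seq_prod f y H)) = Some c))))"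
    for \<Phi> :: "(nat \<Rightarrow> 'a) set \<Rightarrow> 'a \<times> nat set \<times> 'a set" and G r
  have "\<exists>\<Phi>. \<forall>G. P \<Phi> G (\<Phi> G)"
  proof (rule dependent_wf_choice[OF wf_finite_psubset])
    fix \<Phi> \<Psi> :: "(nat \<Rightarrow> 'a) set \<Rightarrow> 'a \<times> nat set \<times> 'a set" and G r
    assume eq: "\<And>F. (F, G) \<in> finite_psubset \<Longrightarrow> \<Phi> F = \<Psi> F"
    show "P \<Phi> G r = P \<Psi> G r"
    proof (cases "G \<in> finite_subsets \<T>")
      case True
      then have "\<Phi> F = \<Psi> F" if "F \<subset> G" for F
        using eq that by (auto simp: finite_subsets_def finite_psubset_def)
      then show ?thesis unfolding P_def by (auto split: prod.split)
    qed (simp add: P_def)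
  next
    fix G and \<Phi> :: "(nat \<Rightarrow> 'a) set \<Rightarrow> 'a \<times> nat set \<times> 'a set"
    assume IH: "\<And>F. (F, G) \<in> finite_psubset \<Longrightarrow> P \<Phi> F (\<Phi> F)"
    show "\<exists>r. P \<Phi> G r"
    proof (cases "G \<in> finite_subsets \<T>")
      case True
      define \<F> where "\<F> = {F \<in> finite_subsets \<T>. F \<subset> G}"
      have "\<F> \<subseteq> Pow G" by (auto simp: \<F>_def)
      then have fin: "finite \<F>"
        using True by (auto simp: finite_subsets_def intro: finite_subset)
      have \<Phi>: "finite (fst (snd (\<Phi> F)))" "finite (snd (snd (\<Phi> F)))" "snd (snd (\<Phi> F)) \<subseteq> star p C"
        if "F \<in> \<F>" for F
        using IH[of F] that True
        by (auto simp: P_def \<F>_def finite_psubset_def finite_subsets_def split: prod.splits)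
      \<comment> \<open>A finite \<open>G\<close> has finitely many subsets, so all products and all
        indices used at proper subsets form finite sets \<open>M\<close> and \<open>N\<close>; the
        new index set starts beyond \<open>N\<close>.\<close>
      define M where "M = (\<Union>F\<in>\<F>. snd (snd (\<Phi> F)))"
      define N where "N = (\<Union>F\<in>\<F>. fst (snd (\<Phi> F)))"
      have M: "finite M" "M \<subseteq> star p C" using \<Phi>(2,3) fin by (auto simp: M_def)
      have "finite N" using \<Phi>(1) fin by (auto simp: N_def)
      then obtain m where m: "\<And>i. i \<in> N \<Longrightarrow> i < m"
        using finite_nat_set_iff_bounded by auto
      obtain a H X where *: "H \<in> finite_subsets UNIV" "H \<subseteq> {m..}" "finite X" "X \<subseteq> star p C"
        "\<forall>y\<in>G. \<exists>c\<in>X. pmult f (Some a) (seq_prod f y H) = Some c"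
        "\<forall>x\<in>M. \<forall>y\<in>G. \<exists>c\<in>X. pmult f (Some x) (pmult f (Some a) (seq_prod f y H)) = Some c"
        using J_set_step[OF p C True[unfolded \<T>] M] by metis
      have "i < j" if "F \<in> finite_subsets \<T>" "F \<subset> G" "i \<in> fst (snd (\<Phi> F))" "j \<in> H" for F i j
      proof -
        have "i \<in> N" using that by (auto simp: N_def \<F>_def)
        then show ?thesis using m *(2) that(4) by fastforce
      qed
      moreover have "x \<in> M" if "F \<in> finite_subsets \<T>" "F \<subset> G" "x \<in> snd (snd (\<Phi> F))" for F x
        using that by (auto simp: M_def \<F>_def)
      ultimately have "P \<Phi> G (a, H, X)"
        using *(1,3-6) unfolding P_def by simp
      then show ?thesis by blast
    qed (simp add: P_def)
  qed
  then obtain \<Phi> where \<Phi>: "\<And>G. P \<Phi> G (\<Phi> G)" by blast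
  have star: "star p C \<subseteq> C" by (auto simp: star_def)
  show ?thesis
  proof (intro exI ballI)
    fix G assume "G \<in> finite_subsets \<T>"
    note * = \<Phi>[of G, unfolded P_def case_prod_beta, THEN mp, OF this]
    show "fst (snd (\<Phi> G)) \<in> finite_subsets UNIV \<and> snd (snd (\<Phi> G)) \<subseteq> C \<and>
      (\<forall>y\<in>G. \<exists>c\<in>snd (snd (\<Phi> G)).
        pmult f (Some (fst (\<Phi> G))) (seq_prod f y (fst (snd (\<Phi> G)))) = Some c) \<and>
      (\<forall>F\<in>finite_subsets \<T>. F \<subset> G \<longrightarrow>
        (\<forall>i\<in>fst (snd (\<Phi> F)). \<forall>j\<in>fst (snd (\<Phi> G)). i < j) \<and>
        (\<forall>x\<in>snd (snd (\<Phi> F)). \<forall>y\<in>G. \<exists>c\<in>snd (snd (\<Phi> G)).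
          pmult f (Some x) (pmult f (Some (fst (\<Phi> G))) (seq_prod f y (fst (snd (\<Phi> G))))) = Some c))"
      using * by (elim conjE, intro conjI) (assumption | rule subset_trans[OF _ star])+
  qed
qed

text \<open>The restriction to \<open>m \<ge> 1\<close> is essential: the product over the empty set
  is undefined and not a unit.\<close>

lemma pprod_Suc:
  assumes "m \<ge> 1"
  shows "pprod f u {1..Suc m} = pmult f (pprod f u {1..m}) (u (Suc m))"
proof -
  have "Some (pprod f u {1..Suc m}) = adj f (Some (u (Suc m))) (Some (pprod f u {1..m}))"
    using assms by (simp add: Some_pprod atLeastAtMostSuc_conv)
  then show ?thesis by (simp add: pm.commute)
qed

end

theorem theorem2p4:
  fixes f :: "'a \<Rightarrow> 'a \<Rightarrow> 'a option"
    and \<T> :: "(nat \<Rightarrow> 'a) set"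
    and C :: "'a set"
  assumes "partial_semigroup f"
    and "partial_commutative f"
    and "adequate f"
    and "\<T> = {y. adequate_seq f y}"
    and "central f C"
  shows "\<exists>(\<alpha> :: (nat \<Rightarrow> 'a) set \<Rightarrow> 'a) (H :: (nat \<Rightarrow> 'a) set \<Rightarrow> nat set).
    H \<in> finite_subsets \<T> \<rightarrow> finite_subsets UNIV \<and>
    (\<forall>F\<in>finite_subsets \<T>. \<forall>G\<in>finite_subsets \<T>. F \<subset> G \<longrightarrow> Max (H F) < Min (H G)) \<and>
    (\<forall>m\<ge>1. \<forall>(G :: nat \<Rightarrow> (nat \<Rightarrow> 'a) set) (y :: nat \<Rightarrow> nat \<Rightarrow> 'a).
       (\<forall>i\<in>{1..m}. G i \<in> finite_subsets \<T>) \<longrightarrow>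
       (\<forall>i\<in>{1..<m}. G i \<subset> G (Suc i)) \<longrightarrow>
       (\<forall>i\<in>{1..m}. y i \<in> G i) \<longrightarrow>
       (\<exists>c\<in>C. pprod f (\<lambda>i. pmult f (Some (\<alpha> (G i))) (seq_prod f (y i) (H (G i)))) {1..m} = Some c))"
proof -
  interpret comm_partial_semigroup f using assms(1,2) by unfold_locales
  obtain p where C: "C \<in> p" and p: "p \<in> smallest_ideal (ultra_mult f) (delta f)" "ultra_mult f p p = p"
    using assms(5) by (auto simp: central_def beta_closure_def)
  \<comment> \<open>The smallest ideal is the intersection of all two-sided ideals, one of which is
    \<open>J_ultrafilters\<close>.\<close>
  have J: "p \<in> J_ultrafilters"
    using p(1) J_ultrafilters_ideal[OF assms(3)] unfolding smallest_ideal_def by blast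
  obtain \<alpha> H X where *: "\<forall>G\<in>finite_subsets \<T>. H G \<in> finite_subsets UNIV \<and> X G \<subseteq> C \<and>
    (\<forall>y\<in>G. \<exists>c\<in>X G. pmult f (Some (\<alpha> G)) (seq_prod f y (H G)) = Some c) \<and>
    (\<forall>F\<in>finite_subsets \<T>. F \<subset> G \<longrightarrow> (\<forall>i\<in>H F. \<forall>j\<in>H G. i < j) \<and>
      (\<forall>x\<in>X F. \<forall>y\<in>G. \<exists>c\<in>X G. pmult f (Some x) (pmult f (Some (\<alpha> G)) (seq_prod f y (H G))) = Some c))"
    using central_recursion[OF J p(2) C assms(4)] by (elim exE)
  have H: "H G \<in> finite_subsets UNIV" and X: "X G \<subseteq> C" if "G \<in> finite_subsets \<T>" for G
    using * that by auto
  have chain_base: "\<exists>c\<in>X G. pmult f (Some (\<alpha> G)) (seq_prod f y (H G)) = Some c"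
    if "G \<in> finite_subsets \<T>" "y \<in> G" for G y
    using * that by simp
  have less: "i < j"
    if "F \<in> finite_subsets \<T>" "G \<in> finite_subsets \<T>" "F \<subset> G" "i \<in> H F" "j \<in> H G" for F G i j
    using * that by simp
  have chain_step: "\<exists>c\<in>X G. pmult f (Some x) (pmult f (Some (\<alpha> G)) (seq_prod f y (H G))) = Some c"
    if "F \<in> finite_subsets \<T>" "G \<in> finite_subsets \<T>" "F \<subset> G" "x \<in> X F" "y \<in> G" for F G x y
    using * that by simp
  \<comment> \<open>Membership in \<open>X (G m)\<close>, rather than only in \<open>C\<close>, is
    the invariant that lets the next factor be multiplied on.\<close>
  have chain: "\<exists>c\<in>X (G m). pprod f (\<lambda>i. pmult f (Some (\<alpha> (G i))) (seq_prod f (y i) (H (G i)))) {1..m} = Some c"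
    if "m \<ge> 1" "\<forall>i\<in>{1..m}. G i \<in> finite_subsets \<T>" "\<forall>i\<in>{1..<m}. G i \<subset> G (Suc i)"
      "\<forall>i\<in>{1..m}. y i \<in> G i" for m and G :: "nat \<Rightarrow> (nat \<Rightarrow> 'a) set" and y
    using that
  proof (induction m rule: dec_induct)
    case base
    then show ?case using chain_base[of "G 1" "y 1"] by (simp add: pprod_def)
  next
    case (step m)
    then obtain x where x: "x \<in> X (G m)"
      "pprod f (\<lambda>i. pmult f (Some (\<alpha> (G i))) (seq_prod f (y i) (H (G i)))) {1..m} = Some x"
      by auto
    show ?case
      unfolding pprod_Suc[OF step.hyps(1)] x(2)
      using step.prems step.hyps x(1) by (intro chain_step[of "G m"]) auto
  qed
  show ?thesis
  proof (intro exI[of _ \<alpha>] exI[of _ H] conjI ballI allI impI)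
    show "H \<in> finite_subsets \<T> \<rightarrow> finite_subsets UNIV" using H by auto
    show "Max (H F) < Min (H G)"
      if "F \<in> finite_subsets \<T>" "G \<in> finite_subsets \<T>" "F \<subset> G" for F G
      using less[OF that] H[OF that(1)] H[OF that(2)] by (auto simp: finite_subsets_def)
    show "\<exists>c\<in>C. pprod f (\<lambda>i. pmult f (Some (\<alpha> (G i))) (seq_prod f (y i) (H (G i)))) {1..m} = Some c"
      if "m \<ge> 1" "\<forall>i\<in>{1..m}. G i \<in> finite_subsets \<T>" "\<forall>i\<in>{1..<m}. G i \<subset> G (Suc i)"
        "\<forall>i\<in>{1..m}. y i \<in> G i" for m and G :: "nat \<Rightarrow> (nat \<Rightarrow> 'a) set" and y
      using chain[OF that] X[of "G m"] that(1,2) by auto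
  qed
qed

end
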